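(* Let $N$ be odd, let $J$ be a persymmetric Jacobi matrix of size $(N+1)\times(N+1)$ with real entries and nonzero off-diagonal entries, with spectral points $x_0<x_1<\dots<x_N$ and weights $w_0,\dots,w_N$, and let $0<\theta<2\pi$. Let $\tilde J=VJV$ be its isospectral deformation and $\tilde w_0,\dots,\tilde w_N$ the weights associated with $\tilde J$ (all as defined in the context). Then the weights $\tilde w_s$ are $$\tilde w_{2s}=w_{2s}\,(1-\sin 2\theta),\qquad \tilde w_{2s+1}=w_{2s+1}\,(1+\sin 2\theta),\qquad s=0,1,\dots,\tfrac{N-1}{2}.$$
   Context: Rows and columns are indexed by $0,\dots,N$, and $e_0,\dots,e_N$ is the canonical basis. $J$ is the real symmetric tridiagonal matrix with diagonal entries $J_{nn}=b_n$ ($n=0,\dots,N$) and off-diagonal entries $J_{n-1,n}=J_{n,n-1}=a_n\neq 0$ ($n=1,\dots,N$); by convention $a_0=a_{N+1}=0$. It is persymmetric, i.e. it commutes with the reflection $e_n\mapsto e_{N-n}$: $b_{N-i}=b_i$ and $a_{N+1-i}=a_i$. Its eigenvalues are real and distinct and are ordered $x_0<x_1<\dots<x_N$. The orthonormal polynomials $\chi_n$ of $J$ are defined by $\chi_{-1}=0$, $\chi_0=1$, $a_{n+1}\chi_{n+1}(x)+b_n\chi_n(x)+a_n\chi_{n-1}(x)=x\chi_n(x)$. The weights $w_s$ are those for which the vectors $X_s=\sum_{n=0}^N\sqrt{w_s}\,\chi_n(x_s)e_n$ are the orthonormal eigenvectors of $J$, $JX_s=x_sX_s$; thus $\sum_{s=0}^N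 w_s\chi_n(x_s)\chi_m(x_s)=\delta_{nm}$. For $N$ odd, $V$ is the $(N+1)\times(N+1)$ matrix with $V_{nn}=\sin\theta$ for $n\le\frac{N-1}{2}$, $V_{nn}=-\sin\theta$ for $n\ge\frac{N+1}{2}$, $V_{n,N-n}=\cos\theta$ for all $n$, and all other entries $0$. It satisfies $V=V^T$ and $V^2=I$. The matrix $\tilde J=VJV$ is again symmetric tridiagonal with the same spectrum $x_0,\dots,x_N$; write $\tilde b_n=\tilde J_{nn}$ and $\tilde a_n=\tilde J_{n-1,n}$. Its entries coincide with those of $J$ except $\tilde a_{(N+1)/2}=a_{(N+1)/2}\cos 2\theta$ and $\tilde b_{(N\mp1)/2}=b_{(N-1)/2}\pm a_{(N+1)/2}\sin 2\theta$. The matrix $\tilde J$ has eigenvectors $\tilde X_s=\sum_{n=0}^N\sqrt{\tilde w_s}\,\tilde\chi_n(x_s)e_n$, where the $\tilde\chi_n$ are orthonormal polynomials satisfying $\tilde a_{n+1}\tilde\chi_{n+1}(x)+\tilde b_n\tilde\chi_n(x)+\tilde a_n\tilde\chi_{n-1}(x)=x\tilde\chi_n(x)$ with $\tilde\chi_{-1}=0$, $\tilde\chi_0=1$, and the $\tilde w_s$ are the corresponding weights: $\sum_{s=0}^N\tilde w_s\tilde\chi_n(x_s)\tilde\chi_m(x_s)=\delta_{nm}$.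
   Formalization: The central off-diagonal entry a_{(N+1)/2} is assumed positive, not merely nonzero; if it is negative the two factors 1−sin 2θ and 1+sin 2θ are swapped (e.g. N=1, b_0=b_1=0, a_1<0), so the claim as stated fails whenever sin 2θ≠0. *)

theory Defs
  imports Complex_Main "HOL-Computational_Algebra.Polynomial" "Jordan_Normal_Form.Char_Poly"
begin

definition jacobi :: "nat \<Rightarrow> real mat \<Rightarrow> bool" where
  "jacobi N J \<longleftrightarrow>
     J \<in> carrier_mat (N + 1) (N + 1) \<and>
     transpose_mat J = J \<and>
     (\<forall>i\<le>N. \<forall>j\<le>N. i + 1 < j \<or> j + 1 < i \<longrightarrow> J $$ (i, j) = 0) \<and>
     (\<forall>n\<in>{1..N}. J $$ (n - 1, n) \<noteq> 0)"

definition reflection_mat :: "nat \<Rightarrow> real mat" where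
  "reflection_mat N = mat (N + 1) (N + 1) (\<lambda>(i, j). if i + j = N then 1 else 0)"

definition persymmetric :: "nat \<Rightarrow> real mat \<Rightarrow> bool" where
  "persymmetric N J \<longleftrightarrow> reflection_mat N * J = J * reflection_mat N"

definition spectral_points :: "nat \<Rightarrow> real mat \<Rightarrow> (nat \<Rightarrow> real) \<Rightarrow> bool" where
  "spectral_points N A x \<longleftrightarrow>
     strict_mono_on {0..N} x \<and> x ` {0..N} = {k. eigenvalue A k}"

text \<open>The recurrence is a polynomial identity for \<open>n < N\<close> only; this determines
  \<open>\<chi> 0, \<dots>, \<chi> N\<close>.  At \<open>n = N\<close>, where \<open>a\<^sub>N\<^sub>+\<^sub>1 = 0\<close>, it holds merely at the
  eigenvalues.  The term in \<open>\<chi>\<^sub>-\<^sub>1 = 0\<close> is dropped at \<open>n = 0\<close>.\<close>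

definition orthonormal_polys :: "nat \<Rightarrow> real mat \<Rightarrow> (nat \<Rightarrow> real poly) \<Rightarrow> bool" where
  "orthonormal_polys N A \<chi> \<longleftrightarrow>
     \<chi> 0 = 1 \<and>
     (\<forall>n<N. Polynomial.smult (A $$ (n, n + 1)) (\<chi> (n + 1)) + Polynomial.smult (A $$ (n, n)) (\<chi> n)
              + (if n = 0 then 0 else Polynomial.smult (A $$ (n - 1, n)) (\<chi> (n - 1)))
            = [:0, 1:] * \<chi> n)"

definition weighted_vec ::
  "nat \<Rightarrow> (nat \<Rightarrow> real) \<Rightarrow> (nat \<Rightarrow> real poly) \<Rightarrow> (nat \<Rightarrow> real) \<Rightarrow> nat \<Rightarrow> real vec" where
  "weighted_vec N x \<chi> w s = vec (N + 1) (\<lambda>n. sqrt (w s) * poly (\<chi> n) (x s))"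

text \<open>Nonnegativity is stated because \<open>sqrt\<close> is an odd function on all of \<open>real\<close>.\<close>

definition weights ::
  "nat \<Rightarrow> real mat \<Rightarrow> (nat \<Rightarrow> real) \<Rightarrow> (nat \<Rightarrow> real poly) \<Rightarrow> (nat \<Rightarrow> real) \<Rightarrow> bool" where
  "weights N A x \<chi> w \<longleftrightarrow>
     (\<forall>s\<le>N. 0 \<le> w s \<and> eigenvector A (weighted_vec N x \<chi> w s) (x s)) \<and>
     (\<forall>s\<le>N. \<forall>t\<le>N. weighted_vec N x \<chi> w s \<bullet> weighted_vec N x \<chi> w t
                       = (if s = t then 1 else 0))"

text \<open>Intended for odd \<open>N\<close>, where the diagonal and the antidiagonal are disjoint.\<close>

definition deformation_mat :: "nat \<Rightarrow> real \<Rightarrow> real mat" where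
  "deformation_mat N \<theta> = mat (N + 1) (N + 1) (\<lambda>(i, j).
     if i = j then (if i \<le> (N - 1) div 2 then sin \<theta> else - sin \<theta>)
     else if i + j = N then cos \<theta>
     else 0)"

definition deformed :: "nat \<Rightarrow> real \<Rightarrow> real mat \<Rightarrow> real mat" where
  "deformed N \<theta> J = deformation_mat N \<theta> * J * deformation_mat N \<theta>"

end

theory Submission
  imports Defs
begin

text \<open>
  Each unit eigenvector \<open>X\<^sub>s\<close> of \<open>J\<close> is symmetric or antisymmetric under the reflection, with sign
  \<open>\<epsilon>\<^sub>s\<close>.  Since \<open>V\<close> is an involution, the \<open>s\<close>-th unit eigenvector of \<open>V J V\<close> is \<open>\<plusminus> V X\<^sub>s\<close>, and comparing
  squared zeroth components gives \<open>w'\<^sub>s = w\<^sub>s (sin \<theta> + \<epsilon>\<^sub>s cos \<theta>)\<^sup>2 = w\<^sub>s (1 + \<epsilon>\<^sub>s sin 2\<theta>)\<close>.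

  To find \<open>\<epsilon>\<^sub>s\<close>, expand the corner entry \<open>(0, N)\<close> of \<open>p(J)\<close> with \<open>p(y) = \<Prod>\<^sub>t\<^sub>\<noteq>\<^sub>s (y - x\<^sub>t)\<close> in two ways.  As
  \<open>J\<close> is tridiagonal and \<open>p\<close> is monic of degree \<open>N\<close>, it is \<open>a\<^sub>1 \<dots> a\<^sub>N\<close>, which is positive because
  persymmetry pairs all factors except the middle one.  Spectrally it is \<open>\<epsilon>\<^sub>s w\<^sub>s p(x\<^sub>s)\<close>.  Hence
  \<open>\<epsilon>\<^sub>s\<close> has the sign of \<open>p(x\<^sub>s)\<close>, which is \<open>(-1)\<close> to the power \<open>N - s\<close>.
\<close>

section \<open>Jacobi matrices: the three-term action and simple eigenspaces\<close>

lemma jacobi_carrier: "jacobi N J \<Longrightarrow> J \<in> carrier_mat (N + 1) (N + 1)"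
  by (simp add: jacobi_def)

lemma jacobi_sym:
  assumes "jacobi N J" "i \<le> N" "j \<le> N"
  shows "J $$ (i, j) = J $$ (j, i)"
proof -
  have "transpose_mat J $$ (i, j) = J $$ (j, i)"
    using jacobi_carrier[OF assms(1)] assms by (intro index_transpose_mat) auto
  then show ?thesis using assms(1) by (simp add: jacobi_def)
qed

lemma jacobi_mult_vec_nth:
  assumes J: "jacobi N J" and v: "v \<in> carrier_vec (N + 1)" and n: "n \<le> N"
  shows "(J *\<^sub>v v) $ n = (if n < N then J $$ (n, n + 1) * v $ (n + 1) else 0) + J $$ (n, n) * v $ n
           + (if n = 0 then 0 else J $$ (n - 1, n) * v $ (n - 1))"
proof -
  let ?f = "\<lambda>j. J $$ (n, j) * v $ j"
  have zero: "J $$ (n, j) = 0" if "j \<le> N" "n + 1 < j \<or> j + 1 < n" for j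
    using J n that unfolding jacobi_def by blast
  have "(J *\<^sub>v v) $ n = (\<Sum>j\<in>{0..<N + 1}. ?f j)"
    using jacobi_carrier[OF J] v n by (auto simp: scalar_prod_def)
  \<comment> \<open>The neighbours of \<open>n\<close> are written so that a missing one is the
    empty set: \<open>n + 1\<close> when \<open>n = N\<close>, and \<open>n - 1\<close> when
    \<open>n = 0\<close>, where truncated subtraction would give \<open>0\<close>.\<close>
  also have "\<dots> = (\<Sum>j\<in>({n + 1} \<inter> {..N}) \<union> {n} \<union> {j. j + 1 = n}. ?f j)"
  proof (rule sum.mono_neutral_right)
    show "({n + 1} \<inter> {..N}) \<union> {n} \<union> {j. j + 1 = n} \<subseteq> {0..<N + 1}" using n by auto
    show "\<forall>j\<in>{0..<N + 1} - (({n + 1} \<inter> {..N}) \<union> {n} \<union> {j. j + 1 = n}). ?f j = 0"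
    proof
      fix j assume "j \<in> {0..<N + 1} - (({n + 1} \<inter> {..N}) \<union> {n} \<union> {j. j + 1 = n})"
      then have "j \<le> N" "n + 1 < j \<or> j + 1 < n" by auto
      then show "?f j = 0" using zero by simp
    qed
  qed simp
  also have "{j. j + 1 = n} = (if n = 0 then {} else {n - 1})" by auto
  also have "{n + 1} \<inter> {..N} = (if n < N then {n + 1} else {})" by auto
  finally show ?thesis
    using n jacobi_sym[OF J, of n "n - 1"] by (cases n) (auto simp: algebra_simps)
qed

text \<open>Row \<open>n - 1\<close> of the eigenvalue equation determines \<open>v $ n\<close> from
  the earlier components, since the off-diagonal entry is nonzero; a zero start therefore
  propagates.\<close>

lemma jacobi_mult_vec_eq_zero:
  assumes J: "jacobi N J" and v: "v \<in> carrier_vec (N + 1)"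
    and Jv: "J *\<^sub>v v = k \<cdot>\<^sub>v v" and v0: "v $ 0 = 0" and n: "n \<le> N"
  shows "v $ n = 0"
  using n
proof (induction n rule: less_induct)
  case (less n)
  show ?case
  proof (cases n)
    case 0
    then show ?thesis using v0 by simp
  next
    case (Suc i)
    have "(J *\<^sub>v v) $ i = k * v $ i" using Jv v Suc less.prems by simp
    moreover have "v $ i = 0" "i \<noteq> 0 \<Longrightarrow> v $ (i - 1) = 0" using less Suc by auto
    ultimately have "J $$ (i, i + 1) * v $ (i + 1) = 0"
      using jacobi_mult_vec_nth[OF J v, of i] Suc less.prems by (auto split: if_splits)
    moreover have "J $$ (i, i + 1) \<noteq> 0"
      using J Suc less.prems unfolding jacobi_def by (auto dest!: bspec[of _ _ n])
    ultimately show ?thesis using Suc by simp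
  qed
qed

text \<open>Subtracting the multiple of \<open>u\<close> that cancels component 0 leaves a solution
  with zero start, which vanishes. The vector \<open>v\<close> may itself be zero.\<close>

lemma jacobi_eigenvector_unique:
  assumes J: "jacobi N J" and u: "eigenvector J u k"
    and v: "v \<in> carrier_vec (N + 1)" and Jv: "J *\<^sub>v v = k \<cdot>\<^sub>v v"
  obtains c where "v = c \<cdot>\<^sub>v u"
proof -
  note carr = jacobi_carrier[OF J]
  have uc: "u \<in> carrier_vec (N + 1)" and Ju: "J *\<^sub>v u = k \<cdot>\<^sub>v u" and "u \<noteq> 0\<^sub>v (N + 1)"
    using u carr by (auto simp: eigenvector_def)
  have u0: "u $ 0 \<noteq> 0"
  proof
    assume "u $ 0 = 0"
    then have "u = 0\<^sub>v (N + 1)"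
      using jacobi_mult_vec_eq_zero[OF J uc Ju] uc by (intro eq_vecI) auto
    with \<open>u \<noteq> 0\<^sub>v (N + 1)\<close> show False ..
  qed
  define c where "c = v $ 0 / u $ 0"
  define z where "z = v - c \<cdot>\<^sub>v u"
  have zc: "z \<in> carrier_vec (N + 1)" using uc v by (simp add: z_def)
  have "J *\<^sub>v z = J *\<^sub>v v - J *\<^sub>v (c \<cdot>\<^sub>v u)"
    unfolding z_def using carr uc v by (intro mult_minus_distrib_mat_vec) auto
  also have "J *\<^sub>v (c \<cdot>\<^sub>v u) = c \<cdot>\<^sub>v (k \<cdot>\<^sub>v u)"
    using mult_mat_vec[OF carr uc] Ju by simp
  also have "J *\<^sub>v v - c \<cdot>\<^sub>v (k \<cdot>\<^sub>v u) = k \<cdot>\<^sub>v z"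
    unfolding Jv z_def using uc v by (intro eq_vecI) (auto simp: algebra_simps)
  finally have "J *\<^sub>v z = k \<cdot>\<^sub>v z" .
  moreover have "z $ 0 = 0" using uc v u0 by (simp add: z_def c_def)
  ultimately have z: "z $ n = 0" if "n \<le> N" for n
    using jacobi_mult_vec_eq_zero[OF J zc] that by blast
  have "v = c \<cdot>\<^sub>v u"
    using z uc v by (intro eq_vecI) (auto simp: z_def less_Suc_eq_le)
  then show thesis by (rule that)
qed

section \<open>Spectral expansion of the corner entry and its sign\<close>

text \<open>A one-sided inverse of a square matrix is two-sided, so orthonormal rows force
  orthonormal columns.\<close>

lemma orthonormal_vecs_columns:
  fixes X :: "nat \<Rightarrow> 'a :: field vec"
  assumes X: "\<And>s. s < d \<Longrightarrow> X s \<in> carrier_vec d"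
    and orth: "\<And>s t. s < d \<Longrightarrow> t < d \<Longrightarrow> X s \<bullet> X t = (if s = t then 1 else 0)"
    and "n < d" "m < d"
  shows "(\<Sum>s<d. X s $ n * X s $ m) = (if n = m then 1 else 0)"
proof -
  define M where "M = mat d d (\<lambda>(s, n). X s $ n)"
  have Mc: "M \<in> carrier_mat d d" by (simp add: M_def)
  have row: "row M s = X s" if "s < d" for s
    using that X[OF that] by (intro eq_vecI) (auto simp: M_def)
  have "M * transpose_mat M = 1\<^sub>m d"
    using Mc orth by (intro eq_matI) (auto simp: row)
  then have "transpose_mat M * M = 1\<^sub>m d"
    by (rule mat_mult_left_right_inverse[OF Mc transpose_carrier_mat[THEN iffD2, OF Mc]])
  then have "(transpose_mat M * M) $$ (n, m) = (if n = m then 1 else 0)"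
    using assms by simp
  moreover have "(transpose_mat M * M) $$ (n, m) = (\<Sum>s<d. X s $ n * X s $ m)"
    using assms(3,4) by (simp add: M_def scalar_prod_def lessThan_atLeast0)
  ultimately show ?thesis by simp
qed

text \<open>The sum is the spectral form of entry \<open>(0, n)\<close> of the \<open>k\<close>-th
  power of \<open>J\<close>. Each factor \<open>J\<close> moves an index by at most one, so fewer
  than \<open>n\<close> factors cannot lead from 0 to \<open>n\<close>, and exactly \<open>n\<close>
  factors do so along a single path.\<close>

lemma jacobi_moment:
  fixes X :: "nat \<Rightarrow> real vec"
  assumes J: "jacobi N J"
    and X: "\<And>s. s \<le> N \<Longrightarrow> X s \<in> carrier_vec (N + 1)"
    and JX: "\<And>s. s \<le> N \<Longrightarrow> J *\<^sub>v X s = x s \<cdot>\<^sub>v X s"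
    and orth: "\<And>s t. s \<le> N \<Longrightarrow> t \<le> N \<Longrightarrow> X s \<bullet> X t = (if s = t then 1 else 0)"
    and "k \<le> n" "n \<le> N"
  shows "(\<Sum>s\<le>N. X s $ 0 * x s ^ k * X s $ n) = (if k = n then \<Prod>i<n. J $$ (i, i + 1) else 0)"
  using assms(5,6)
proof (induction k arbitrary: n)
  case 0
  have "(\<Sum>s<N + 1. X s $ 0 * X s $ n) = (if 0 = n then 1 else 0)"
    using X orth 0 by (intro orthonormal_vecs_columns) auto
  then show ?case by (auto simp: lessThan_Suc_atMost)
next
  case (Suc k)
  then obtain i where i: "n = Suc i" by (cases n) auto
  let ?L = "\<lambda>n. \<Sum>s\<le>N. X s $ 0 * x s ^ k * X s $ n"
  have "x s * X s $ n = (if n < N then J $$ (n, n + 1) * X s $ (n + 1) else 0)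
          + J $$ (n, n) * X s $ n + J $$ (i, n) * X s $ i" if "s \<le> N" for s
    using jacobi_mult_vec_nth[OF J X[OF that] Suc.prems(2)] JX[OF that] X[OF that] Suc.prems(2) i
    by simp
  then have "(\<Sum>s\<le>N. X s $ 0 * x s ^ Suc k * X s $ n)
      = (\<Sum>s\<le>N. X s $ 0 * x s ^ k * ((if n < N then J $$ (n, n + 1) * X s $ (n + 1) else 0)
          + J $$ (n, n) * X s $ n + J $$ (i, n) * X s $ i))"
    by (intro sum.cong refl) (simp add: mult.assoc mult.left_commute)
  also have "\<dots> = (if n < N then J $$ (n, n + 1) * ?L (n + 1) else 0)
          + J $$ (n, n) * ?L n + J $$ (i, n) * ?L i"
    by (cases "n < N") (simp_all add: sum_distrib_left sum.distrib distrib_left mult.left_commute)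
  \<comment> \<open>Here \<open>k < n\<close>, so the induction hypothesis kills the moments at
    \<open>n + 1\<close> and \<open>n\<close>; only the one at \<open>i = n - 1\<close> can
    survive.\<close>
  also have "(if n < N then J $$ (n, n + 1) * ?L (n + 1) else 0) = 0"
    using Suc by simp
  also have "?L n = 0" using Suc by simp
  also have "?L i = (if k = i then \<Prod>i<i. J $$ (i, i + 1) else 0)"
    using Suc i by simp
  finally show ?case using i by simp
qed

text \<open>The polynomial vanishing at all spectral points but \<open>x s\<close> isolates one
  spectral term. It is monic of degree \<open>N\<close>, so only its leading coefficient meets a
  nonzero moment.\<close>

lemma jacobi_corner:
  fixes X :: "nat \<Rightarrow> real vec"
  assumes J: "jacobi N J"
    and X: "\<And>s. s \<le> N \<Longrightarrow> X s \<in> carrier_vec (N + 1)"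
    and JX: "\<And>s. s \<le> N \<Longrightarrow> J *\<^sub>v X s = x s \<cdot>\<^sub>v X s"
    and orth: "\<And>s t. s \<le> N \<Longrightarrow> t \<le> N \<Longrightarrow> X s \<bullet> X t = (if s = t then 1 else 0)"
    and s: "s \<le> N"
  shows "X s $ 0 * X s $ N * (\<Prod>t\<in>{..N} - {s}. x s - x t) = (\<Prod>i<N. J $$ (i, i + 1))"
proof -
  define p where "p = (\<Prod>t\<in>{..N} - {s}. [:- x t, 1:])"
  have deg: "degree p = N"
    unfolding p_def using s by (subst degree_prod_eq_sum_degree) auto
  have lead: "lead_coeff p = 1"
    unfolding p_def by (simp add: lead_coeff_prod)
  have p: "poly p y = (\<Prod>t\<in>{..N} - {s}. y - x t)" for y
    by (simp add: p_def poly_prod)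
  have "(\<Sum>t\<le>N. X t $ 0 * poly p (x t) * X t $ N)
      = (\<Sum>t\<le>N. \<Sum>k\<le>N. coeff p k * (X t $ 0 * x t ^ k * X t $ N))"
    by (simp add: poly_altdef deg sum_distrib_left sum_distrib_right mult_ac)
  also have "\<dots> = (\<Sum>k\<le>N. coeff p k * (\<Sum>t\<le>N. X t $ 0 * x t ^ k * X t $ N))"
    by (subst sum.swap) (simp add: sum_distrib_left)
  also have "\<dots> = (\<Sum>k\<le>N. if k = N then coeff p k * (\<Prod>i<N. J $$ (i, i + 1)) else 0)"
    using jacobi_moment[OF J X JX orth] by (intro sum.cong refl) simp
  also have "\<dots> = (\<Prod>i<N. J $$ (i, i + 1))" using lead deg by simp
  finally have "(\<Sum>t\<le>N. X t $ 0 * poly p (x t) * X t $ N) = (\<Prod>i<N. J $$ (i, i + 1))" .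
  moreover have "(\<Sum>t\<le>N. X t $ 0 * poly p (x t) * X t $ N)
      = (\<Sum>t\<in>{s}. X t $ 0 * poly p (x t) * X t $ N)"
  proof (rule sum.mono_neutral_right)
    show "\<forall>t\<in>{..N} - {s}. X t $ 0 * poly p (x t) * X t $ N = 0"
      by (auto simp: p)
  qed (use s in auto)
  ultimately show ?thesis by (simp add: p mult_ac)
qed

text \<open>The factors with \<open>t < s\<close> are positive; the \<open>N - s\<close> factors
  with \<open>t > s\<close> are negative.\<close>

lemma sign_prod_differences:
  fixes x :: "nat \<Rightarrow> real"
  assumes mono: "strict_mono_on {0..N} x" and s: "s \<le> N"
  shows "0 < (- 1) ^ (N - s) * (\<Prod>t\<in>{..N} - {s}. x s - x t)"
proof -
  have less: "x i < x j" if "i < j" "j \<le> N" for i j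
    using strict_mono_onD[OF mono, of i j] that by auto
  have decomp: "{..N} - {s} = {..<s} \<union> {s<..N}" using s by auto
  have "(\<Prod>t\<in>{..N} - {s}. x s - x t) = (\<Prod>t<s. x s - x t) * (\<Prod>t\<in>{s<..N}. x s - x t)"
    unfolding decomp by (rule prod.union_disjoint) auto
  also have "(\<Prod>t\<in>{s<..N}. x s - x t) = (\<Prod>t\<in>{s<..N}. - 1 * (x t - x s))" by simp
  also have "\<dots> = (- 1) ^ (N - s) * (\<Prod>t\<in>{s<..N}. x t - x s)"
    by (subst prod.distrib) simp
  finally have "(- 1) ^ (N - s) * (\<Prod>t\<in>{..N} - {s}. x s - x t)
      = (\<Prod>t<s. x s - x t) * (\<Prod>t\<in>{s<..N}. x t - x s)"
    by (cases "even (N - s)") simp_all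
  moreover have "0 < (\<Prod>t<s. x s - x t)" "0 < (\<Prod>t\<in>{s<..N}. x t - x s)"
    using less s by (auto intro!: prod_pos)
  ultimately show ?thesis by simp
qed

section \<open>Reflection, persymmetry and the parity of eigenvectors\<close>

lemma reflection_mat_carrier: "reflection_mat N \<in> carrier_mat (N + 1) (N + 1)"
  by (simp add: reflection_mat_def)

lemma reflection_mat_mult_vec_nth:
  assumes v: "v \<in> carrier_vec (N + 1)" and n: "n \<le> N"
  shows "(reflection_mat N *\<^sub>v v) $ n = v $ (N - n)"
proof -
  have "(reflection_mat N *\<^sub>v v) $ n = (\<Sum>j\<in>{0..<N + 1}. (if n + j = N then 1 else 0) * v $ j)"
    using v n by (simp add: reflection_mat_def scalar_prod_def)
  also have "\<dots> = (\<Sum>j\<in>{0..<N + 1}. if j = N - n then v $ j else 0)"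
    using n by (intro sum.cong) auto
  also have "\<dots> = v $ (N - n)" using n by simp
  finally show ?thesis .
qed

lemma persymmetric_nth:
  assumes J: "jacobi N J" and P: "persymmetric N J" and "i \<le> N" "j \<le> N"
  shows "J $$ (N - i, j) = J $$ (i, N - j)"
proof -
  note carr = jacobi_carrier[OF J]
  have sym: "transpose_mat J = J" using J by (simp add: jacobi_def)
  have trR: "transpose_mat (reflection_mat N) = reflection_mat N"
    by (intro eq_matI) (auto simp: reflection_mat_def add.commute)
  have RJ: "(reflection_mat N * J) $$ (i, j) = J $$ (N - i, j)" if "i \<le> N" "j \<le> N" for i j
  proof -
    have "(reflection_mat N * J) $$ (i, j) = (reflection_mat N *\<^sub>v col J j) $ i"
      using carr reflection_mat_carrier[of N] that by simp
    also have "\<dots> = col J j $ (N - i)"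
      using carr that by (intro reflection_mat_mult_vec_nth) (auto intro!: carrier_vecI)
    finally show ?thesis using carr that by simp
  qed
  \<comment> \<open>Both matrices are symmetric, so transposing carries the row formula
    \<open>RJ\<close> over to the product in the other order.\<close>
  have "transpose_mat (reflection_mat N * J) = transpose_mat J * transpose_mat (reflection_mat N)"
    using carr reflection_mat_carrier by (intro transpose_mult) auto
  then have "J * reflection_mat N = transpose_mat (reflection_mat N * J)"
    by (simp add: sym trR)
  then have "(J * reflection_mat N) $$ (i, j) = (reflection_mat N * J) $$ (j, i)"
    using carr reflection_mat_carrier[of N] assms(3,4) by simp
  then have "J $$ (N - i, j) = J $$ (N - j, i)"
    using P RJ assms(3,4) by (simp add: persymmetric_def)
  then show ?thesis using jacobi_sym[OF J, of "N - j" i] assms(3) by simp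
qed

text \<open>The reflection exchanges the off-diagonal entries at \<open>i\<close> and
  \<open>2 * m - i\<close> and fixes only the middle one.\<close>

lemma persymmetric_offdiag_prod:
  assumes J: "jacobi N J" and P: "persymmetric N J" and N: "N = 2 * m + 1"
  shows "(\<Prod>i<N. J $$ (i, i + 1)) = (\<Prod>i<m. J $$ (i, i + 1))\<^sup>2 * J $$ (m, m + 1)"
proof -
  let ?a = "\<lambda>i. J $$ (i, i + 1)"
  have mirror: "?a (2 * m - i) = ?a i" if "i \<le> 2 * m" for i
  proof -
    have "J $$ (N - (i + 1), N - i) = J $$ (i + 1, N - (N - i))"
      using that N by (intro persymmetric_nth[OF J P]) auto
    also have "\<dots> = J $$ (i, i + 1)" using that N jacobi_sym[OF J, of "i + 1" i] by simp
    finally show ?thesis using that N by (simp add: Suc_diff_le)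
  qed
  have decomp: "{..<N} = insert m ({..<m} \<union> {m<..2 * m})" using N by auto
  have "(\<Prod>i<N. ?a i) = ?a m * (\<Prod>i\<in>{..<m} \<union> {m<..2 * m}. ?a i)"
    unfolding decomp by (rule prod.insert) auto
  also have "(\<Prod>i\<in>{..<m} \<union> {m<..2 * m}. ?a i) = (\<Prod>i<m. ?a i) * (\<Prod>i\<in>{m<..2 * m}. ?a i)"
    by (rule prod.union_disjoint) auto
  also have "(\<Prod>i\<in>{m<..2 * m}. ?a i) = (\<Prod>i<m. ?a i)"
    by (rule prod.reindex_bij_witness[where i = "\<lambda>i. 2 * m - i" and j = "\<lambda>i. 2 * m - i"])
      (use mirror in auto)
  finally show ?thesis by (simp add: power2_eq_square mult_ac)
qed

text \<open>The reflected eigenvector has the same eigenvalue, hence is a multiple \<open>c\<close>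
  of the original. Reflecting twice gives \<open>c * c = 1\<close>, and the corner identity decides
  the sign.\<close>

lemma persymmetric_eigenvector_parity:
  fixes X :: "nat \<Rightarrow> real vec"
  assumes N: "N = 2 * m + 1" and J: "jacobi N J" and P: "persymmetric N J"
    and a: "0 < J $$ (m, m + 1)" and mono: "strict_mono_on {0..N} x"
    and ev: "\<And>s. s \<le> N \<Longrightarrow> eigenvector J (X s) (x s)"
    and orth: "\<And>s t. s \<le> N \<Longrightarrow> t \<le> N \<Longrightarrow> X s \<bullet> X t = (if s = t then 1 else 0)"
    and s: "s \<le> N"
  shows "X s $ N = (- 1) ^ (N - s) * X s $ 0"
proof -
  note carr = jacobi_carrier[OF J]
  have X: "X s \<in> carrier_vec (N + 1)" and JX: "J *\<^sub>v X s = x s \<cdot>\<^sub>v X s" if "s \<le> N" for s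
    using ev[OF that] carr by (auto simp: eigenvector_def)
  have nz: "J $$ (i, i + 1) \<noteq> 0" if "i < m" for i
    using J that N unfolding jacobi_def by (auto dest!: bspec[of _ _ "i + 1"])
  let ?R = "reflection_mat N"
  have "J *\<^sub>v (?R *\<^sub>v X s) = (?R * J) *\<^sub>v X s"
    using P carr reflection_mat_carrier[of N] X[OF s] by (simp add: persymmetric_def)
  also have "\<dots> = ?R *\<^sub>v (x s \<cdot>\<^sub>v X s)"
    using carr reflection_mat_carrier[of N] X[OF s] JX[OF s] by simp
  also have "\<dots> = x s \<cdot>\<^sub>v (?R *\<^sub>v X s)"
    using mult_mat_vec[OF reflection_mat_carrier X[OF s]] by simp
  finally obtain c where c: "?R *\<^sub>v X s = c \<cdot>\<^sub>v X s"
    using jacobi_eigenvector_unique[OF J ev[OF s]] X[OF s] reflection_mat_carrier[of N]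
    by (metis mult_mat_vec_carrier)
  have XN: "X s $ N = c * X s $ 0" and X0: "X s $ 0 = c * X s $ N"
    using arg_cong[OF c, of "\<lambda>v. v $ 0"] arg_cong[OF c, of "\<lambda>v. v $ N"]
      reflection_mat_mult_vec_nth[OF X[OF s], of 0] reflection_mat_mult_vec_nth[OF X[OF s], of N]
      X[OF s] by auto
  let ?q = "\<Prod>t\<in>{..N} - {s}. x s - x t"
  \<comment> \<open>The paired entries contribute a nonzero square, so the sign of the product is
    that of the middle entry.\<close>
  have "0 < (\<Prod>i<N. J $$ (i, i + 1))"
    unfolding persymmetric_offdiag_prod[OF J P N] using a nz by (auto intro!: mult_pos_pos)
  then have pos: "0 < c * (X s $ 0)\<^sup>2 * ?q"
    using jacobi_corner[OF J X JX orth s] by (simp add: XN power2_eq_square mult_ac)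
  then have "X s $ 0 \<noteq> 0" by auto
  moreover have "X s $ 0 = c * c * X s $ 0" using XN X0 by simp
  ultimately have "c * c = 1" by simp
  then have "c = 1 \<or> c = - 1" using square_eq_1_iff by blast
  \<comment> \<open>Both \<open>c\<close> and \<open>(- 1) ^ (N - s)\<close> are 1 or -1 and share
    the sign of \<open>?q\<close>, so they agree.\<close>
  moreover have "0 < (- 1) ^ (N - s) * ?q" using sign_prod_differences[OF mono s] .
  moreover have "0 < c * ?q"
    using pos by (auto simp: zero_less_mult_iff mult_less_0_iff)
  ultimately have "c = (- 1) ^ (N - s)"
    by (cases "even (N - s)") auto
  then show ?thesis using XN by simp
qed

section \<open>The deformation matrix and the deformed eigenvectors\<close>

lemma deformation_mat_carrier: "deformation_mat N \<theta> \<in> carrier_mat (N + 1) (N + 1)"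
  by (simp add: deformation_mat_def)

lemma deformation_mat_mult_vec_nth:
  assumes N: "odd N" and v: "v \<in> carrier_vec (N + 1)" and n: "n \<le> N"
  shows "(deformation_mat N \<theta> *\<^sub>v v) $ n
           = (if n \<le> (N - 1) div 2 then sin \<theta> else - sin \<theta>) * v $ n + cos \<theta> * v $ (N - n)"
proof -
  let ?d = "if n \<le> (N - 1) div 2 then sin \<theta> else - sin \<theta>"
  have ne: "n \<noteq> N - n" using N n by presburger
  have "(deformation_mat N \<theta> *\<^sub>v v) $ n
      = (\<Sum>j\<in>{0..<N + 1}. (if n = j then ?d else if n + j = N then cos \<theta> else 0) * v $ j)"
    using v n by (simp add: deformation_mat_def scalar_prod_def)
  also have "\<dots> = (\<Sum>j\<in>{n, N - n}. (if n = j then ?d else if n + j = N then cos \<theta> else 0) * v $ j)"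
    by (rule sum.mono_neutral_right) (use n in auto)
  finally show ?thesis using ne n by simp
qed

lemma deformation_mat_involution:
  assumes N: "odd N" and v: "v \<in> carrier_vec (N + 1)"
  shows "deformation_mat N \<theta> *\<^sub>v (deformation_mat N \<theta> *\<^sub>v v) = v"
proof (rule eq_vecI)
  let ?V = "deformation_mat N \<theta>"
  have Vv: "?V *\<^sub>v v \<in> carrier_vec (N + 1)"
    using deformation_mat_carrier v by (rule mult_mat_vec_carrier)
  fix n assume "n < dim_vec v"
  then have n: "n \<le> N" using v by simp
  \<comment> \<open>Exactly one of \<open>n\<close> and \<open>N - n\<close> lies in the first half,
    so their diagonal entries have opposite signs and the mixed sine-cosine terms cancel.\<close>
  have half: "N - n \<le> (N - 1) div 2 \<longleftrightarrow> \<not> n \<le> (N - 1) div 2" using N n by presburger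
  have "(?V *\<^sub>v (?V *\<^sub>v v)) $ n = sin \<theta> * (sin \<theta> * v $ n) + cos \<theta> * (cos \<theta> * v $ n)"
    using n half
    by (simp only: deformation_mat_mult_vec_nth[OF N v] deformation_mat_mult_vec_nth[OF N Vv]
        diff_diff_cancel diff_le_self) (simp add: algebra_simps)
  also have "\<dots> = ((sin \<theta>)\<^sup>2 + (cos \<theta>)\<^sup>2) * v $ n"
    by (simp only: power2_eq_square distrib_right mult.assoc)
  finally show "(?V *\<^sub>v (?V *\<^sub>v v)) $ n = v $ n" by simp
qed (use v deformation_mat_carrier[of N \<theta>] in auto)

lemma deformation_mat_sym: "transpose_mat (deformation_mat N \<theta>) = deformation_mat N \<theta>"
  by (intro eq_matI) (auto simp: deformation_mat_def add.commute)

text \<open>The image of \<open>v\<close> under the deformation matrix is an eigenvector of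
  \<open>J\<close> for \<open>k\<close>, hence a multiple of \<open>u\<close>; squaring hides the
  remaining sign.\<close>

lemma deformed_weight:
  assumes N: "odd N" and J: "jacobi N J"
    and u: "eigenvector J u k" and uu: "u \<bullet> u = 1"
    and v: "eigenvector (deformed N \<theta> J) v k" and vv: "v \<bullet> v = 1"
  shows "(v $ 0)\<^sup>2 = (sin \<theta> * u $ 0 + cos \<theta> * u $ N)\<^sup>2"
proof -
  let ?V = "deformation_mat N \<theta>"
  note carr = jacobi_carrier[OF J] and V = deformation_mat_carrier[of N \<theta>]
  have uc: "u \<in> carrier_vec (N + 1)"
    using u carr by (auto simp: eigenvector_def)
  have vc: "v \<in> carrier_vec (N + 1)" and ev: "(?V * J * ?V) *\<^sub>v v = k \<cdot>\<^sub>v v"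
    using v V by (auto simp: eigenvector_def deformed_def)
  have Vv: "?V *\<^sub>v v \<in> carrier_vec (N + 1)" using V vc by (rule mult_mat_vec_carrier)
  have JVv: "J *\<^sub>v (?V *\<^sub>v v) \<in> carrier_vec (N + 1)" using carr Vv by (rule mult_mat_vec_carrier)
  have VJV: "?V *\<^sub>v (J *\<^sub>v (?V *\<^sub>v v)) = k \<cdot>\<^sub>v v"
    using ev assoc_mult_mat_vec[OF mult_carrier_mat[OF V carr] V vc]
      assoc_mult_mat_vec[OF V carr Vv] by simp
  have "J *\<^sub>v (?V *\<^sub>v v) = ?V *\<^sub>v (k \<cdot>\<^sub>v v)"
    using deformation_mat_involution[OF N JVv] VJV by metis
  also have "\<dots> = k \<cdot>\<^sub>v (?V *\<^sub>v v)" using mult_mat_vec[OF V vc] .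
  finally obtain c where c: "?V *\<^sub>v v = c \<cdot>\<^sub>v u"
    using jacobi_eigenvector_unique[OF J u Vv] by metis
  \<comment> \<open>A symmetric involution preserves the norm, which forces the factor
    \<open>c\<close> to be 1 or -1.\<close>
  have "(?V *\<^sub>v v) \<bullet> (?V *\<^sub>v v) = v \<bullet> (?V *\<^sub>v (?V *\<^sub>v v))"
    using transpose_vec_mult_scalar[OF V Vv vc] comm_scalar_prod[OF vc]
      comm_scalar_prod[OF Vv Vv] deformation_mat_sym[of N \<theta>] V Vv
    by (metis mult_mat_vec_carrier comm_scalar_prod vc)
  then have "(c \<cdot>\<^sub>v u) \<bullet> (c \<cdot>\<^sub>v u) = 1"
    unfolding deformation_mat_involution[OF N vc] vv unfolding c .
  then have "c * c = 1" using uu uc by simp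
  then have c2: "c\<^sup>2 = 1" by (simp add: power2_eq_square)
  have "v = ?V *\<^sub>v (c \<cdot>\<^sub>v u)" using deformation_mat_involution[OF N vc] c by metis
  then have "v $ 0 = c * (sin \<theta> * u $ 0 + cos \<theta> * u $ N)"
    using deformation_mat_mult_vec_nth[OF N, of "c \<cdot>\<^sub>v u" 0 \<theta>] uc
    by (simp add: algebra_simps)
  then show ?thesis by (simp add: power_mult_distrib c2)
qed

section \<open>The formula for the deformed weights\<close>

lemma weighted_vec_zero:
  assumes "orthonormal_polys N A \<chi>"
  shows "weighted_vec N x \<chi> w s $ 0 = sqrt (w s)"
  using assms by (simp add: orthonormal_polys_def weighted_vec_def)

theorem proposition4p1:
  fixes N :: nat and J :: "real mat" and \<theta> :: real
    and x w w' :: "nat \<Rightarrow> real" and \<chi> \<chi>' :: "nat \<Rightarrow> real poly"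
  assumes "odd N"
    and "jacobi N J"
    and "persymmetric N J"
    and "0 < J $$ ((N - 1) div 2, (N + 1) div 2)"
    and "0 < \<theta>" and "\<theta> < 2 * pi"
    and "spectral_points N J x"
    and "orthonormal_polys N J \<chi>"
    and "weights N J x \<chi> w"
    and "orthonormal_polys N (deformed N \<theta> J) \<chi>'"
    and "weights N (deformed N \<theta> J) x \<chi>' w'"
  shows "\<forall>s\<le>(N - 1) div 2.
           w' (2 * s) = w (2 * s) * (1 - sin (2 * \<theta>)) \<and>
           w' (2 * s + 1) = w (2 * s + 1) * (1 + sin (2 * \<theta>))"
proof -
  define m where "m = (N - 1) div 2"
  have N: "N = 2 * m + 1" using \<open>odd N\<close> unfolding m_def by presburger
  have a: "0 < J $$ (m, m + 1)" using assms(4) N by simp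
  let ?X = "weighted_vec N x \<chi> w" and ?Y = "weighted_vec N x \<chi>' w'"
  have mono: "strict_mono_on {0..N} x" using assms(7) by (simp add: spectral_points_def)
  have w: "w' r = w r * (1 + (- 1) ^ (N - r) * sin (2 * \<theta>))" if r: "r \<le> N" for r
  proof -
    have parity: "?X r $ N = (- 1) ^ (N - r) * ?X r $ 0"
      using assms(9) r
      by (intro persymmetric_eigenvector_parity[OF N assms(2,3) a mono]) (auto simp: weights_def)
    have "(?Y r $ 0)\<^sup>2 = (sin \<theta> * ?X r $ 0 + cos \<theta> * ?X r $ N)\<^sup>2"
      using assms(9,11) r
      by (intro deformed_weight[OF assms(1,2), where k = "x r"]) (auto simp: weights_def)
    also have "\<dots> = (?X r $ 0)\<^sup>2 * (sin \<theta> + (- 1) ^ (N - r) * cos \<theta>)\<^sup>2"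
      unfolding parity by (simp add: algebra_simps flip: power_mult_distrib)
    \<comment> \<open>The sign squares to 1, so it survives only in the cross term, which is the
      double-angle sine.\<close>
    also have "(sin \<theta> + (- 1) ^ (N - r) * cos \<theta>)\<^sup>2 = 1 + (- 1) ^ (N - r) * sin (2 * \<theta>)"
      using sin_cos_squared_add[of \<theta>]
      by (cases "even (N - r)") (auto simp: power2_sum power2_diff sin_double)
    \<comment> \<open>Since \<open>\<chi> 0 = 1\<close>, the zeroth components are square roots of
      the weights; nonnegativity makes their squares the weights themselves.\<close>
    finally show ?thesis
      using assms(9,11) r
      by (simp add: weighted_vec_zero[OF assms(8)] weighted_vec_zero[OF assms(10)] weights_def)
  qed
  show ?thesis
  proof (intro allI impI conjI)
    fix s assume "s \<le> (N - 1) div 2"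
    \<comment> \<open>As \<open>N\<close> is odd, an even index leaves an odd exponent and hence the
      minus sign.\<close>
    then have le: "2 * s + 1 \<le> N" and "odd (N - 2 * s)" "even (N - (2 * s + 1))"
      using N by auto
    then show "w' (2 * s) = w (2 * s) * (1 - sin (2 * \<theta>))"
      "w' (2 * s + 1) = w (2 * s + 1) * (1 + sin (2 * \<theta>))"
      using w[of "2 * s"] w[of "2 * s + 1"] by auto
  qed
qed

end
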